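(* Let $t\ge1$, $h\in\mathbb{R}^t$ and $\epsilon\ge 0$. The stepsize pattern $h$ is $\epsilon$-straightforward if for some $\Delta\in(0,1/2]$ the set $\mathcal{S}_{h,\epsilon,\Delta}$ is nonempty, where $\mathcal{S}_{h,\epsilon,\Delta}$ is the set of all $(\lambda,\gamma)\in\mathbb{R}^{(t+2)\times(t+2)}\times\mathbb{R}^{(t+2)\times(t+2)}$ (rows and columns indexed by $I_t^\star=\{\star,0,1,\dots,t\}$) satisfying $$\sum_{i,j\in I_t^\star: i\ne j}\lambda_{i,j}a_{i,j}=a_{\star,t}-a_{\star,0},\qquad \sum_{i,j\in I_t^\star: i\neq j}\gamma_{i,j}a_{i,j}=2\sum_{i=0}^{t-1}h_i\,a_{\star,0},$$ $$ m_h(\lambda)=0,\qquad \lambda\ge0,\qquad \lambda+\Delta\gamma\ge0 \quad\text{(entrywise)},$$ $$\begin{bmatrix}\sum_{i=0}^{t-1}(h_i+\epsilon) & m_h(\gamma)^T\\ m_h(\gamma)& M_h(\lambda)\end{bmatrix}\succeq0,\qquad \begin{bmatrix}\sum_{i=0}^{t-1}(h_i+\epsilon) & m_h(\gamma)^T\\ m_h(\gamma)& M_h(\lambda+\Delta\gamma)\end{bmatrix}\succeq0 .$$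
   Context: Straightforwardness: for a pattern $h=(h_0,\dots,h_{t-1})\in\mathbb{R}^t$, problem dimension $n$, and $L,D>0$, $p_{L,D}(\delta)$ is the supremum of $f(x_t)-f(x_\star)$ over all convex differentiable $f:\mathbb{R}^n\to\mathbb{R}$ with $L$-Lipschitz gradient and $x_0,x_\star\in\mathbb{R}^n$ with $\nabla f(x_\star)=0$, $\|x_0-x_\star\|_2\le D$, $f(x_0)-f(x_\star)\le\delta$, where $x_{k+1}=x_k-\frac{h_k}{L}\nabla f(x_k)$ for $k=0,\dots,t-1$. $h$ is $\epsilon$-straightforward if for some $\Delta\in(0,1/2]$ and any $L,D>0$, $p_{L,D}(\delta)\le \delta-\frac{\sum_{i=0}^{t-1}(h_i-\epsilon)}{LD^2}\delta^2$ for all $\delta\in[0,LD^2\Delta]$. Notation (with $e_i$ standard basis vectors): in $\mathbb{R}^{t+2}$ set $\mathbf g_\star=0$, $\mathbf g_i=e_{i+2}$ for $0\le i\le t$, $\mathbf x_\star=0$, $\mathbf x_0=e_1$, $\mathbf x_i=\mathbf x_0-\sum_{j=0}^{i-1}h_j\mathbf g_j$ for $1\le i\le t$; in $\mathbb{R}^{t+1}$ set $\mathbf f_\star=0$, $\mathbf f_i=e_{i+1}$ for $0\le i\le t$. With $x\odot y=\frac12(xy^T+yx^T)$, for $i,j\in I_t^\star$ set $A_{i,j}(h)=\mathbf g_j\odot(\mathbf x_i-\mathbf x_j)$, $C_{i,j}=(\mathbf g_i-\mathbf g_j)\odot(\mathbf g_i-\mathbf g_j)$, $a_{i,j}=\mathbf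 f_j-\mathbf f_i$. For $\lambda\in\mathbb{R}^{(t+2)\times(t+2)}$, the matrix $\sum_{i,j\in I_t^\star:i\ne j}\lambda_{i,j}\left(A_{i,j}(h)+\frac12C_{i,j}\right)$ has zero $(1,1)$ entry; the linear maps $m_h(\lambda)\in\mathbb{R}^{t+1}$ and $M_h(\lambda)\in\mathbb{R}^{(t+1)\times(t+1)}$ are defined by writing it in block form as $$\begin{bmatrix}0& m_h(\lambda)^T\\ m_h(\lambda)&M_h(\lambda)\end{bmatrix}.$$ *)

theory Defs
  imports "HOL-Analysis.Analysis" "Jordan_Normal_Form.Matrix"
begin

unbundle no vec_syntax and no inner_syntax
hide_const (open) Finite_Cartesian_Product.vec Finite_Cartesian_Product.mat
hide_type (open) Finite_Cartesian_Product.vec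

section \<open>Straightforward stepsize patterns\<close>

text \<open>
  The problem space is \<open>real ^ 'n\<close>; the dimension enters as a type argument. The map \<open>g\<close> is
  the gradient of \<open>f\<close>. The supremum is taken in the extended reals, so no boundedness is
  presupposed.
\<close>

definition worst_case ::
  "'n::finite itself \<Rightarrow> real vec \<Rightarrow> real \<Rightarrow> real \<Rightarrow> real \<Rightarrow> ereal" where
  "worst_case _ h L D \<delta> =
     Sup {ereal (f (x (dim_vec h)) - f xs) | (f :: real ^ 'n \<Rightarrow> real) g x xs.
            convex_on UNIV f \<and> (\<forall>y. GDERIV f y :> g y) \<and> L-lipschitz_on UNIV g \<and>
            g xs = 0 \<and> norm (x 0 - xs) \<le> D \<and> f (x 0) - f xs \<le> \<delta> \<and>
            (\<forall>k<dim_vec h. x (Suc k) = x k - (h $ k / L) *\<^sub>R g (x k))}"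

definition straightforward :: "'n::finite itself \<Rightarrow> real vec \<Rightarrow> real \<Rightarrow> bool" where
  "straightforward T h \<epsilon> \<longleftrightarrow>
     (\<exists>\<Delta>. 0 < \<Delta> \<and> \<Delta> \<le> 1/2 \<and>
       (\<forall>L>0. \<forall>D>0. \<forall>\<delta>\<in>{0..L * D\<^sup>2 * \<Delta>}.
          worst_case T h L D \<delta>
            \<le> ereal (\<delta> - (\<Sum>i<dim_vec h. h $ i - \<epsilon>) / (L * D\<^sup>2) * \<delta>\<^sup>2)))"

section \<open>Certificates\<close>

text \<open>
  The index set \<open>{\<star>, 0, \<dots>, t}\<close> is encoded by \<open>{..<t + 2}\<close>: \<open>0\<close> stands for \<open>\<star>\<close> and \<open>Suc i\<close>
  for \<open>i\<close>. Entries of vectors and matrices are counted from \<open>0\<close>, so the \<open>k\<close>-th standard basis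
  vector of the \<open>n\<close>-dimensional space is \<open>unit_vec n (k - 1)\<close>. The multiplier matrix \<open>\<Lambda>\<close> is
  the paper's lower-case lambda, which is reserved for abstraction.
\<close>

fun gvec :: "nat \<Rightarrow> nat \<Rightarrow> real vec" where
  "gvec t 0 = 0\<^sub>v (t + 2)"
| "gvec t (Suc i) = unit_vec (t + 2) (i + 1)"

fun xvec :: "real vec \<Rightarrow> nat \<Rightarrow> real vec" where
  "xvec h 0 = 0\<^sub>v (dim_vec h + 2)"
| "xvec h (Suc i) = unit_vec (dim_vec h + 2) 0 -
     finsum_vec TYPE(real) (dim_vec h + 2) (\<lambda>j. h $ j \<cdot>\<^sub>v gvec (dim_vec h) (Suc j)) {..<i}"

fun fvec :: "nat \<Rightarrow> nat \<Rightarrow> real vec" where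
  "fvec t 0 = 0\<^sub>v (t + 1)"
| "fvec t (Suc i) = unit_vec (t + 1) i"

definition sym_outer :: "real vec \<Rightarrow> real vec \<Rightarrow> real mat" (infixl "\<odot>" 70) where
  "x \<odot> y = mat (dim_vec x) (dim_vec y) (\<lambda>(p, q). (x $ p * y $ q + y $ p * x $ q) / 2)"

definition Amat :: "real vec \<Rightarrow> nat \<Rightarrow> nat \<Rightarrow> real mat" where
  "Amat h i j = gvec (dim_vec h) j \<odot> (xvec h i - xvec h j)"

definition Cmat :: "nat \<Rightarrow> nat \<Rightarrow> nat \<Rightarrow> real mat" where
  "Cmat t i j = (gvec t i - gvec t j) \<odot> (gvec t i - gvec t j)"

definition avec :: "nat \<Rightarrow> nat \<Rightarrow> nat \<Rightarrow> real vec" where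
  "avec t i j = fvec t j - fvec t i"

definition off_diag :: "nat \<Rightarrow> (nat \<times> nat) set" where
  "off_diag t = {(i, j). i < t + 2 \<and> j < t + 2 \<and> i \<noteq> j}"

definition a_comb :: "nat \<Rightarrow> real mat \<Rightarrow> real vec" where
  "a_comb t \<Lambda> = finsum_vec TYPE(real) (t + 1)
     (\<lambda>(i, j). \<Lambda> $$ (i, j) \<cdot>\<^sub>v avec t i j) (off_diag t)"

definition AC_comb :: "real vec \<Rightarrow> real mat \<Rightarrow> real mat" where
  "AC_comb h \<Lambda> = mat (dim_vec h + 2) (dim_vec h + 2)
     (\<lambda>(p, q). \<Sum>(i, j)\<in>off_diag (dim_vec h).
        \<Lambda> $$ (i, j) * (Amat h i j + (1/2) \<cdot>\<^sub>m Cmat (dim_vec h) i j) $$ (p, q))"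

definition m_blk :: "real vec \<Rightarrow> real mat \<Rightarrow> real vec" where
  "m_blk h \<Lambda> = vec (dim_vec h + 1) (\<lambda>p. AC_comb h \<Lambda> $$ (Suc p, 0))"

definition M_blk :: "real vec \<Rightarrow> real mat \<Rightarrow> real mat" where
  "M_blk h \<Lambda> = mat (dim_vec h + 1) (dim_vec h + 1) (\<lambda>(p, q). AC_comb h \<Lambda> $$ (Suc p, Suc q))"

definition bordered :: "real \<Rightarrow> real vec \<Rightarrow> real mat \<Rightarrow> real mat" where
  "bordered s m M = four_block_mat
     (mat 1 1 (\<lambda>_. s))              (mat_of_rows (dim_vec m) [m])
     (mat_of_cols (dim_vec m) [m])  M"

definition psd :: "real mat \<Rightarrow> bool" where
  "psd A \<longleftrightarrow> square_mat A \<and> A\<^sup>T = A \<and> (\<forall>v\<in>carrier_vec (dim_row A). 0 \<le> v \<bullet> (A *\<^sub>v v))"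

definition nonneg_mat :: "real mat \<Rightarrow> bool" where
  "nonneg_mat A \<longleftrightarrow> (\<forall>i<dim_row A. \<forall>j<dim_col A. 0 \<le> A $$ (i, j))"

definition certificates :: "real vec \<Rightarrow> real \<Rightarrow> real \<Rightarrow> (real mat \<times> real mat) set" where
  "certificates h \<epsilon> \<Delta> = (let t = dim_vec h; s = (\<Sum>i<t. h $ i + \<epsilon>) in
     {(\<Lambda>, \<gamma>). \<Lambda> \<in> carrier_mat (t + 2) (t + 2) \<and> \<gamma> \<in> carrier_mat (t + 2) (t + 2) \<and>
        a_comb t \<Lambda> = avec t 0 (Suc t) - avec t 0 (Suc 0) \<and>
        a_comb t \<gamma> = (2 * (\<Sum>i<t. h $ i)) \<cdot>\<^sub>v avec t 0 (Suc 0) \<and>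
        m_blk h \<Lambda> = 0\<^sub>v (t + 1) \<and>
        nonneg_mat \<Lambda> \<and> nonneg_mat (\<Lambda> + \<Delta> \<cdot>\<^sub>m \<gamma>) \<and>
        psd (bordered s (m_blk h \<gamma>) (M_blk h \<Lambda>)) \<and>
        psd (bordered s (m_blk h \<gamma>) (M_blk h (\<Lambda> + \<Delta> \<cdot>\<^sub>m \<gamma>)))})"

text \<open>
  \<open>AC_comb_blocks\<close> below is the block form that introduces \<open>m_blk\<close> and \<open>M_blk\<close>.
\<close>

lemma dim_gvec: "dim_vec (gvec t i) = t + 2"
  by (cases i) auto

lemma finsum_gvec_carrier:
  "finsum_vec TYPE(real) (dim_vec h + 2) (\<lambda>j. h $ j \<cdot>\<^sub>v gvec (dim_vec h) (Suc j)) S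
     \<in> carrier_vec (dim_vec h + 2)"
  by (rule finsum_vec_closed, rule Pi_I, rule carrier_vecI) (simp only: dim_gvec index_smult_vec)

lemma dim_xvec: "dim_vec (xvec h i) = dim_vec h + 2"
proof (cases i)
  case 0
  show ?thesis unfolding 0 xvec.simps by (rule index_zero_vec)
next
  case (Suc k)
  show ?thesis unfolding Suc xvec.simps index_minus_vec
    by (rule carrier_vecD[OF finsum_gvec_carrier])
qed

lemma Amat_Cmat_index:
  assumes "p < dim_vec h + 2" "q < dim_vec h + 2"
  shows "(Amat h i j + (1/2) \<cdot>\<^sub>m Cmat (dim_vec h) i j) $$ (p, q) =
    (gvec (dim_vec h) j $ p * (xvec h i - xvec h j) $ q +
     (xvec h i - xvec h j) $ p * gvec (dim_vec h) j $ q) / 2 +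
    (1/2) * (((gvec (dim_vec h) i - gvec (dim_vec h) j) $ p *
    (gvec (dim_vec h) i - gvec (dim_vec h) j) $ q +
    (gvec (dim_vec h) i - gvec (dim_vec h) j) $ p *
    (gvec (dim_vec h) i - gvec (dim_vec h) j) $ q) / 2)"
  using assms
  by (simp only: Amat_def Cmat_def sym_outer_def dim_gvec dim_xvec index_mat index_add_mat
      index_smult_mat index_minus_vec dim_row_mat dim_col_mat split)

lemma AC_comb_sym:
  assumes "p < dim_vec h + 2" "q < dim_vec h + 2"
  shows "AC_comb h \<Lambda> $$ (p, q) = AC_comb h \<Lambda> $$ (q, p)"
proof -
  have "(Amat h i j + (1/2) \<cdot>\<^sub>m Cmat (dim_vec h) i j) $$ (p, q) =
        (Amat h i j + (1/2) \<cdot>\<^sub>m Cmat (dim_vec h) i j) $$ (q, p)" for i j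
    unfolding Amat_Cmat_index[OF assms] Amat_Cmat_index[OF assms(2,1)] by (simp only: ac_simps)
  then show ?thesis
    using assms by (simp only: AC_comb_def index_mat split)
qed

lemma gvec_0: "gvec t i $ 0 = 0"
  by (cases i) (simp_all add: unit_vec_def)

lemma AC_comb_0: "AC_comb h \<Lambda> $$ (0, 0) = 0"
proof -
  have z: "0 < dim_vec h + 2" by simp
  have g: "(gvec (dim_vec h) i - gvec (dim_vec h) j) $ 0 = 0" for i j
    by (subst index_minus_vec(1)) (simp_all only: dim_gvec gvec_0 z diff_self)
  have "(Amat h i j + (1/2) \<cdot>\<^sub>m Cmat (dim_vec h) i j) $$ (0, 0) = 0" for i j
    unfolding Amat_Cmat_index[OF z z] g gvec_0 by (simp only: mult_zero_left mult_zero_right add_0 div_0)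
  then show ?thesis
    by (simp only: AC_comb_def index_mat z split mult_zero_right sum.neutral_const case_prod_unfold
        fst_conv snd_conv)
qed

lemma AC_comb_blocks: "AC_comb h \<Lambda> = bordered 0 (m_blk h \<Lambda>) (M_blk h \<Lambda>)"
proof (rule eq_matI)
  fix p q
  assume "p < dim_row (bordered 0 (m_blk h \<Lambda>) (M_blk h \<Lambda>))"
    and "q < dim_col (bordered 0 (m_blk h \<Lambda>) (M_blk h \<Lambda>))"
  then have pq: "p < dim_vec h + 2" "q < dim_vec h + 2"
    by (auto simp: bordered_def m_blk_def M_blk_def)
  show "AC_comb h \<Lambda> $$ (p, q) = bordered 0 (m_blk h \<Lambda>) (M_blk h \<Lambda>) $$ (p, q)"
    using pq AC_comb_sym[OF pq, of \<Lambda>] AC_comb_0[of h \<Lambda>]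
    by (cases p; cases q)
      (simp_all add: bordered_def m_blk_def M_blk_def mat_of_rows_def mat_of_cols_def)
qed (simp_all add: bordered_def m_blk_def M_blk_def AC_comb_def)

end

theory Submission
  imports Defs
begin

text \<open>
  After dividing by \<open>L\<close>, the interpolation inequality of a smooth convex function at the points
  \<open>i\<close> and \<open>j\<close> says that \<open>avec t i j\<close> evaluated at the function values plus
  \<open>Amat h i j + (1/2) \<cdot>\<^sub>m Cmat t i j\<close> evaluated at the Gram matrix of \<open>x 0 - xs\<close> and the gradients
  is at most \<open>0\<close>. Weight these inequalities with \<open>\<Lambda> + d \<cdot>\<^sub>m \<gamma>\<close> for \<open>d = \<delta> / (L * D\<^sup>2)\<close>, which
  is nonnegative as a convex combination of \<open>\<Lambda>\<close> and \<open>\<Lambda> + \<Delta> \<cdot>\<^sub>m \<gamma>\<close>. The same convex combination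
  of the two semidefiniteness conditions bounds the quadratic part from below by
  \<open>- s * d\<^sup>2 * (norm (x 0 - xs))\<^sup>2\<close>, \<open>s\<close> being the corner entry. What remains is
  \<open>(f (x t) - f xs) / L \<le> (1 - 2 * d * H) * (f (x 0) - f xs) / L + s * d\<^sup>2 * (norm (x 0 - xs))\<^sup>2\<close>,
  \<open>H\<close> being the sum of the stepsizes, and shrinking \<open>\<Delta>\<close> makes the factor \<open>1 - 2 * d * H\<close>
  nonnegative, so that \<open>\<delta>\<close> may be inserted.
\<close>

section \<open>Smooth convex functions\<close>

lemma GDERIV_line:
  fixes f :: "'a::real_inner \<Rightarrow> real"
  assumes "GDERIV f (x + s *\<^sub>R d) :> g"
  shows "((\<lambda>s. f (x + s *\<^sub>R d)) has_real_derivative inner g d) (at s within S)"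
proof -
  have "(f has_derivative (\<lambda>h. inner h g)) (at (x + s *\<^sub>R d))"
    using assms by (simp add: gderiv_def)
  then have "((\<lambda>s. f (x + s *\<^sub>R d)) has_derivative (\<lambda>r. inner (r *\<^sub>R d) g)) (at s within S)"
    by (rule has_derivative_compose[rotated]) (auto intro!: derivative_eq_intros)
  then show ?thesis
    by (simp add: has_field_derivative_def mult.commute[of _ "inner _ _"] inner_commute)
qed

text \<open>Restriction to the line through \<open>x\<close> and \<open>y\<close> reduces this to
  the one-variable tangent inequality, applied to \<open>\<phi>\<close> at 0 and 1.\<close>

lemma convex_on_ge_tangent:
  fixes f :: "'a::real_inner \<Rightarrow> real"
  assumes "convex_on UNIV f" and "GDERIV f x :> g"
  shows "f y \<ge> f x + inner g (y - x)"
proof -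
  define \<phi> where "\<phi> = (\<lambda>s. f (x + s *\<^sub>R (y - x)))"
  have "convex_on UNIV \<phi>"
  proof (rule convex_onI)
    fix s a b :: real assume "0 < s" "s < 1"
    have "x + ((1 - s) * a + s * b) *\<^sub>R (y - x)
        = (1 - s) *\<^sub>R (x + a *\<^sub>R (y - x)) + s *\<^sub>R (x + b *\<^sub>R (y - x))"
      by (simp add: algebra_simps)
    with \<open>0 < s\<close> \<open>s < 1\<close>
    show "\<phi> ((1 - s) *\<^sub>R a + s *\<^sub>R b) \<le> (1 - s) * \<phi> a + s * \<phi> b"
      unfolding \<phi>_def using convex_onD[OF assms(1), of s "x + a *\<^sub>R (y - x)" "x + b *\<^sub>R (y - x)"]
      by simp
  qed simp
  moreover have "(\<phi> has_real_derivative inner g (y - x)) (at 0 within UNIV)"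
    unfolding \<phi>_def by (rule GDERIV_line) (simp add: assms(2))
  ultimately have "\<phi> 1 - \<phi> 0 \<ge> inner g (y - x) * (1 - 0)"
    by (intro convex_on_imp_above_tangent[of UNIV]) auto
  then show ?thesis
    by (simp add: \<phi>_def)
qed

lemma lipschitz_gradient_quadratic_upper_bound:
  fixes f :: "'a::real_inner \<Rightarrow> real"
  assumes "\<And>y. GDERIV f y :> g y" and "L-lipschitz_on UNIV g"
  shows "f z \<le> f y + inner (g y) (z - y) + L / 2 * (norm (z - y))\<^sup>2"
proof -
  define d where "d = z - y"
  \<comment> \<open>\<open>\<phi>\<close> is \<open>f\<close> along the segment minus the terms of
    the claimed bound that vary with \<open>s\<close>; Cauchy-Schwarz and the Lipschitz condition
    make its derivative nonpositive.\<close>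
  define \<phi> where "\<phi> = (\<lambda>s. f (y + s *\<^sub>R d) - s * inner (g y) d - L / 2 * s\<^sup>2 * (norm d)\<^sup>2)"
  have "\<phi> 1 \<le> \<phi> 0"
  proof (rule DERIV_nonpos_imp_nonincreasing[where f = \<phi>])
    fix s :: real assume "0 \<le> s" "s \<le> 1"
    have "DERIV \<phi> s :> inner (g (y + s *\<^sub>R d)) d - inner (g y) d - L * s * (norm d)\<^sup>2"
      unfolding \<phi>_def by (auto intro!: derivative_eq_intros GDERIV_line assms(1))
    moreover have "inner (g (y + s *\<^sub>R d) - g y) d \<le> L * s * (norm d)\<^sup>2"
    proof -
      have "inner (g (y + s *\<^sub>R d) - g y) d \<le> norm (g (y + s *\<^sub>R d) - g y) * norm d"
        by (rule norm_cauchy_schwarz)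
      also have "\<dots> \<le> L * norm (s *\<^sub>R d) * norm d"
        using lipschitz_onD[OF assms(2), of "y + s *\<^sub>R d" y]
        by (intro mult_right_mono) (simp_all add: dist_norm)
      finally show ?thesis
        using \<open>0 \<le> s\<close> by (simp add: power2_eq_square algebra_simps)
    qed
    ultimately show "\<exists>D. DERIV \<phi> s :> D \<and> D \<le> 0"
      by (auto simp: inner_diff_left)
  qed simp
  then show ?thesis
    by (simp add: \<phi>_def d_def)
qed

text \<open>The function \<open>f u - inner (g x) u\<close> is convex with minimizer
  \<open>x\<close>, and \<open>z\<close> is its gradient step of length \<open>1 / L\<close> from
  \<open>y\<close>. Bounding \<open>f z\<close> below by the tangent at \<open>x\<close> and above
  by the quadratic at \<open>y\<close> leaves half of \<open>(norm d)\<^sup>2 / L\<close> as the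
  gain.\<close>

lemma smooth_convex_interpolation:
  fixes f :: "'a::real_inner \<Rightarrow> real"
  assumes "L > 0" and "convex_on UNIV f" and "\<And>y. GDERIV f y :> g y" and "L-lipschitz_on UNIV g"
  shows "f y \<ge> f x + inner (g x) (y - x) + (norm (g y - g x))\<^sup>2 / (2 * L)"
proof -
  define d where "d = g y - g x"
  define z where "z = y - (1 / L) *\<^sub>R d"
  have "f x + inner (g x) (z - x) \<le> f z"
    by (rule convex_on_ge_tangent[OF assms(2,3)])
  also have "\<dots> \<le> f y + inner (g y) (z - y) + L / 2 * (norm (z - y))\<^sup>2"
    by (rule lipschitz_gradient_quadratic_upper_bound[OF assms(3,4)])
  also have "L / 2 * (norm (z - y))\<^sup>2 = (norm d)\<^sup>2 / (2 * L)"
    using \<open>L > 0\<close> by (simp add: z_def power_divide power2_eq_square)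
  also have "inner (g y) (z - y) = inner (g x) (z - y) - (norm d)\<^sup>2 / L"
  proof -
    have "inner (g y) (z - y) = inner (g x) (z - y) + inner d (z - y)"
      by (simp add: d_def inner_diff_left)
    also have "inner d (z - y) = - (norm d)\<^sup>2 / L"
      by (simp add: z_def power2_norm_eq_inner)
    finally show ?thesis by simp
  qed
  finally have "f x + inner (g x) (y - x) + (norm d)\<^sup>2 / L \<le> f y + (norm d)\<^sup>2 / (2 * L)"
    by (simp add: inner_diff_right)
  then show ?thesis
    unfolding d_def[symmetric] using \<open>L > 0\<close> by simp
qed

section \<open>Quadratic forms at Gram matrices\<close>

text \<open>For square \<open>A\<close> this is the trace pairing of \<open>A\<close> with the Gram
  matrix of \<open>V\<close>.\<close>

definition gram_form :: "(nat \<Rightarrow> 'a::real_inner) \<Rightarrow> real mat \<Rightarrow> real" where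
  "gram_form V A = (\<Sum>p<dim_row A. \<Sum>q<dim_col A. A $$ (p, q) * inner (V p) (V q))"

text \<open>The linear map from symbolic coordinate vectors to the objects they stand for: points
  and gradients, or function values when \<open>V\<close> is real-valued.\<close>

definition vec_comb :: "(nat \<Rightarrow> 'a::real_vector) \<Rightarrow> real vec \<Rightarrow> 'a" where
  "vec_comb V u = (\<Sum>p<dim_vec u. u $ p *\<^sub>R V p)"

text \<open>A Gram matrix is a sum of rank-one matrices, one for each coordinate \<open>b\<close> of
  the ambient space, and \<open>psd\<close> applies to each of these separately.\<close>

lemma gram_form_nonneg:
  fixes V :: "nat \<Rightarrow> 'a::euclidean_space"
  assumes "psd A"
  shows "0 \<le> gram_form V A"
proof -
  define n where "n = dim_row A"
  have n: "dim_col A = n"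
    using assms by (simp add: psd_def square_mat.simps n_def)
  have "0 \<le> (\<Sum>p<n. \<Sum>q<n. A $$ (p, q) * (inner (V p) b * inner (V q) b))" for b
  proof -
    define v where "v = vec n (\<lambda>p. inner (V p) b)"
    have "0 \<le> v \<bullet> (A *\<^sub>v v)"
      using assms by (simp add: psd_def v_def n_def)
    also have "\<dots> = (\<Sum>p<n. v $ p * (\<Sum>q<n. A $$ (p, q) * v $ q))"
      by (simp add: scalar_prod_def mult_mat_vec_def n n_def[symmetric] v_def atLeast0LessThan)
    also have "\<dots> = (\<Sum>p<n. \<Sum>q<n. A $$ (p, q) * (inner (V p) b * inner (V q) b))"
      by (simp add: v_def sum_distrib_left mult_ac)
    finally show ?thesis .
  qed
  then have "0 \<le> (\<Sum>b\<in>Basis. \<Sum>p<n. \<Sum>q<n. A $$ (p, q) * (inner (V p) b * inner (V q) b))"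
    by (rule sum_nonneg)
  also have "\<dots> = (\<Sum>p<n. \<Sum>b\<in>Basis. \<Sum>q<n. A $$ (p, q) * (inner (V p) b * inner (V q) b))"
    by (rule sum.swap)
  also have "\<dots> = (\<Sum>p<n. \<Sum>q<n. \<Sum>b\<in>Basis. A $$ (p, q) * (inner (V p) b * inner (V q) b))"
    by (intro sum.cong refl sum.swap)
  also have "\<dots> = gram_form V A"
    unfolding gram_form_def n n_def[symmetric]
    by (simp add: euclidean_inner[of "V _" "V _"] sum_distrib_left)
  finally show ?thesis .
qed

lemma gram_form_sym_outer:
  assumes "dim_vec x = dim_vec y"
  shows "gram_form V (x \<odot> y) = inner (vec_comb V x) (vec_comb V y)"
proof -
  define n where "n = dim_vec y"
  have n: "dim_vec x = n" "dim_vec y = n" using assms by (simp_all add: n_def)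
  have prod: "(\<Sum>p<n. \<Sum>q<n. (u $ p * w $ q) * inner (V p) (V q)) = inner (vec_comb V u) (vec_comb V w)"
    if "dim_vec u = n" "dim_vec w = n" for u w
    using that by (subst sum.swap) (simp add: vec_comb_def inner_sum_left inner_sum_right sum_distrib_left mult_ac)
  have "2 * gram_form V (x \<odot> y) = (\<Sum>p<n. \<Sum>q<n. (x $ p * y $ q) * inner (V p) (V q)
      + (y $ p * x $ q) * inner (V p) (V q))"
    by (simp add: gram_form_def sym_outer_def n sum_distrib_left distrib_right
        add_divide_distrib)
  also have "\<dots> = inner (vec_comb V x) (vec_comb V y) + inner (vec_comb V y) (vec_comb V x)"
    unfolding sum.distrib prod[OF n] prod[OF n(2,1)] ..
  finally show ?thesis
    by (simp add: inner_commute)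
qed

lemma gram_form_add:
  assumes "A \<in> carrier_mat m n" "B \<in> carrier_mat m n"
  shows "gram_form V (A + B) = gram_form V A + gram_form V B"
  using assms by (simp add: gram_form_def sum.distrib distrib_right)

lemma gram_form_smult: "gram_form V (c \<cdot>\<^sub>m A) = c * gram_form V A"
  by (simp add: gram_form_def sum_distrib_left mult.assoc)

lemma vec_comb_minus:
  assumes "dim_vec u = dim_vec v"
  shows "vec_comb V (u - v) = vec_comb V u - vec_comb V v"
  using assms by (simp add: vec_comb_def scaleR_left_diff_distrib sum_subtractf)

lemma vec_comb_zero: "vec_comb V (0\<^sub>v n) = 0"
  by (simp add: vec_comb_def)

lemma vec_comb_unit:
  assumes "k < n"
  shows "vec_comb V (unit_vec n k) = V k"
proof -
  have "vec_comb V (unit_vec n k) = (\<Sum>p<n. if p = k then V p else 0)"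
    unfolding vec_comb_def using assms by (intro sum.cong) auto
  then show ?thesis using assms by simp
qed

lemma vec_comb_smult: "vec_comb V (c \<cdot>\<^sub>v u) = c *\<^sub>R vec_comb V u"
  by (simp add: vec_comb_def scaleR_sum_right)

lemma vec_comb_finsum:
  assumes "finite S" and "\<And>i. i \<in> S \<Longrightarrow> u i \<in> carrier_vec n"
  shows "vec_comb V (finsum_vec TYPE(real) n u S) = (\<Sum>i\<in>S. vec_comb V (u i))"
proof -
  have u: "u \<in> S \<rightarrow> carrier_vec n" using assms(2) by auto
  have "vec_comb V (finsum_vec TYPE(real) n u S) = (\<Sum>p<n. (\<Sum>i\<in>S. u i $ p) *\<^sub>R V p)"
    unfolding vec_comb_def carrier_vecD[OF finsum_vec_closed[OF u]]
    by (intro sum.cong refl) (simp add: index_finsum_vec[OF assms(1) _ u])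
  also have "\<dots> = (\<Sum>i\<in>S. \<Sum>p<n. u i $ p *\<^sub>R V p)"
    unfolding scaleR_sum_left by (rule sum.swap)
  also have "\<dots> = (\<Sum>i\<in>S. vec_comb V (u i))"
    by (intro sum.cong refl) (simp add: vec_comb_def carrier_vecD[OF assms(2)])
  finally show ?thesis .
qed

text \<open>Turns the symbolic matrix into the inner products of the interpolation inequalities. The
  right-hand side also makes linearity in the multipliers visible.\<close>

lemma gram_form_AC_comb:
  fixes h V defines "t \<equiv> dim_vec h"
  shows "gram_form V (AC_comb h \<Lambda>) = (\<Sum>(i, j)\<in>off_diag t. \<Lambda> $$ (i, j) *
     (inner (vec_comb V (gvec t j)) (vec_comb V (xvec h i) - vec_comb V (xvec h j)) +
      (norm (vec_comb V (gvec t i) - vec_comb V (gvec t j)))\<^sup>2 / 2))"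
proof -
  define X where "X i j = Amat h i j + (1/2) \<cdot>\<^sub>m Cmat t i j" for i j
  have car: "Amat h i j \<in> carrier_mat (t + 2) (t + 2)" "Cmat t i j \<in> carrier_mat (t + 2) (t + 2)" for i j
    by (auto simp: Amat_def Cmat_def sym_outer_def dim_gvec dim_xvec t_def)
  have X: "gram_form V (X i j) = inner (vec_comb V (gvec t j)) (vec_comb V (xvec h i) - vec_comb V (xvec h j)) +
      (norm (vec_comb V (gvec t i) - vec_comb V (gvec t j)))\<^sup>2 / 2" for i j
    unfolding X_def
    by (subst gram_form_add[OF car(1)])
      (use car in \<open>auto simp: gram_form_smult Amat_def Cmat_def gram_form_sym_outer dim_gvec dim_xvec
        vec_comb_minus t_def[symmetric] power2_norm_eq_inner\<close>)
  have dX: "dim_row (X i j) = t + 2" "dim_col (X i j) = t + 2" for i j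
    using car[of i j] by (auto simp: X_def)
  have "gram_form V (AC_comb h \<Lambda>)
      = (\<Sum>p<t+2. \<Sum>q<t+2. \<Sum>z\<in>off_diag t. \<Lambda> $$ z * (X (fst z) (snd z) $$ (p, q) * inner (V p) (V q)))"
    unfolding gram_form_def AC_comb_def t_def[symmetric] X_def[symmetric]
    by (simp add: sum_distrib_right case_prod_unfold mult.assoc)
  also have "\<dots> = (\<Sum>z\<in>off_diag t. \<Lambda> $$ z * gram_form V (X (fst z) (snd z)))"
    unfolding gram_form_def dX sum_distrib_left
    by (subst sum.swap[of _ "off_diag t"], intro sum.cong refl sum.swap)
  finally show ?thesis
    by (simp add: X case_prod_unfold)
qed

lemma gram_form_AC_comb_add_smult:
  assumes "\<Lambda> \<in> carrier_mat (dim_vec h + 2) (dim_vec h + 2)"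
    and "\<gamma> \<in> carrier_mat (dim_vec h + 2) (dim_vec h + 2)"
  shows "gram_form V (AC_comb h (\<Lambda> + c \<cdot>\<^sub>m \<gamma>)) =
    gram_form V (AC_comb h \<Lambda>) + c * gram_form V (AC_comb h \<gamma>)"
  unfolding gram_form_AC_comb sum_distrib_left sum.distrib[symmetric]
  by (intro sum.cong refl) (use assms in \<open>auto simp: off_diag_def algebra_simps\<close>)

lemma gram_form_bordered:
  assumes "dim_vec m = n" and "M \<in> carrier_mat n n"
  shows "gram_form V (bordered s m M) = s * (norm (V 0))\<^sup>2 +
    2 * (\<Sum>p<n. m $ p * inner (V 0) (V (Suc p))) + gram_form (V \<circ> Suc) M"
proof -
  have dim: "dim_row (bordered s m M) = Suc n" "dim_col (bordered s m M) = Suc n"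
    using assms by (auto simp: bordered_def)
  have entries: "bordered s m M $$ (0, 0) = s"
    "p < n \<Longrightarrow> bordered s m M $$ (0, Suc p) = m $ p"
    "p < n \<Longrightarrow> bordered s m M $$ (Suc p, 0) = m $ p"
    "p < n \<Longrightarrow> q < n \<Longrightarrow> bordered s m M $$ (Suc p, Suc q) = M $$ (p, q)" for p q
    using assms by (auto simp: bordered_def mat_of_rows_def mat_of_cols_def)
  show ?thesis
    using assms(2)
    by (simp add: gram_form_def dim sum.lessThan_Suc_shift sum.distrib entries
        power2_norm_eq_inner inner_commute del: sum.lessThan_Suc)
qed

lemma dim_m_blk: "dim_vec (m_blk h \<Lambda>) = dim_vec h + 1"
  by (simp add: m_blk_def)

lemma M_blk_carrier: "M_blk h \<Lambda> \<in> carrier_mat (dim_vec h + 1) (dim_vec h + 1)"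
  by (simp add: M_blk_def)

section \<open>Performance bound from a certificate\<close>

lemma vec_comb_gvec:
  "vec_comb V (gvec t 0) = 0"
  "i \<le> t \<Longrightarrow> vec_comb V (gvec t (Suc i)) = V (Suc i)"
  by (simp_all add: vec_comb_zero vec_comb_unit)

lemma vec_comb_fvec:
  "vec_comb V (fvec t 0) = 0"
  "i \<le> t \<Longrightarrow> vec_comb V (fvec t (Suc i)) = V i"
  by (simp_all add: vec_comb_zero vec_comb_unit)

lemma dim_fvec: "dim_vec (fvec t i) = t + 1"
  by (cases i) auto

lemma dim_avec: "dim_vec (avec t i j) = t + 1"
  by (simp add: avec_def dim_fvec)

lemma vec_comb_avec: "vec_comb V (avec t i j) = vec_comb V (fvec t j) - vec_comb V (fvec t i)"
  by (simp add: avec_def vec_comb_minus dim_fvec)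

lemma vec_comb_xvec:
  fixes h V defines "t \<equiv> dim_vec h"
  shows "vec_comb V (xvec h 0) = 0"
    and "i \<le> t \<Longrightarrow> vec_comb V (xvec h (Suc i)) = V 0 - (\<Sum>j<i. h $ j *\<^sub>R V (Suc j))"
proof -
  show "vec_comb V (xvec h 0) = 0"
    by (simp add: vec_comb_zero)
  assume i: "i \<le> t"
  have car: "h $ j \<cdot>\<^sub>v gvec t (Suc j) \<in> carrier_vec (t + 2)" for j
    by (rule carrier_vecI) (simp only: dim_gvec index_smult_vec)
  have "vec_comb V (xvec h (Suc i)) = vec_comb V (unit_vec (t + 2) 0) -
      vec_comb V (finsum_vec TYPE(real) (t + 2) (\<lambda>j. h $ j \<cdot>\<^sub>v gvec t (Suc j)) {..<i})"
    unfolding xvec.simps t_def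
    by (rule vec_comb_minus) (simp only: carrier_vecD[OF finsum_gvec_carrier] index_unit_vec)
  also have "\<dots> = V 0 - (\<Sum>j<i. h $ j *\<^sub>R vec_comb V (gvec t (Suc j)))"
    by (subst vec_comb_finsum) (use car in \<open>auto simp only: vec_comb_unit vec_comb_smult\<close>)
  also have "\<dots> = V 0 - (\<Sum>j<i. h $ j *\<^sub>R V (Suc j))"
    using i by (simp add: vec_comb_gvec del: gvec.simps)
  finally show "vec_comb V (xvec h (Suc i)) = V 0 - (\<Sum>j<i. h $ j *\<^sub>R V (Suc j))" .
qed

lemma vec_comb_a_comb:
  "vec_comb V (a_comb t \<Lambda>) = (\<Sum>(i, j)\<in>off_diag t. \<Lambda> $$ (i, j) *\<^sub>R vec_comb V (avec t i j))"
proof -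
  have "off_diag t \<subseteq> {..<t+2} \<times> {..<t+2}" by (auto simp: off_diag_def)
  then have "finite (off_diag t)" by (rule finite_subset) simp
  moreover have "\<Lambda> $$ z \<cdot>\<^sub>v avec t (fst z) (snd z) \<in> carrier_vec (t + 1)" for z
    by (rule carrier_vecI) (simp only: index_smult_vec dim_avec)
  ultimately show ?thesis
    unfolding a_comb_def case_prod_unfold prod.collapse
    by (simp only: vec_comb_finsum vec_comb_smult)
qed

text \<open>Both semidefiniteness conditions have the same corner and border, so their convex
  combination changes only the lower block. Since \<open>m_blk h \<Lambda>\<close> vanishes, the
  border of the combined multiplier is \<open>d\<close> times that of
  \<open>\<gamma>\<close>.\<close>

lemma bordered_blocks_nonneg:
  fixes V :: "nat \<Rightarrow> 'a::euclidean_space"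
  assumes car: "\<Lambda> \<in> carrier_mat (dim_vec h + 2) (dim_vec h + 2)"
      "\<gamma> \<in> carrier_mat (dim_vec h + 2) (dim_vec h + 2)"
    and m: "m_blk h \<Lambda> = 0\<^sub>v (dim_vec h + 1)"
    and psd1: "psd (bordered s (m_blk h \<gamma>) (M_blk h \<Lambda>))"
    and psd2: "psd (bordered s (m_blk h \<gamma>) (M_blk h (\<Lambda> + \<Delta> \<cdot>\<^sub>m \<gamma>)))"
    and "0 < \<Delta>" "0 \<le> d" "d \<le> \<Delta>"
  shows "0 \<le> s * d\<^sup>2 * (norm (V 0))\<^sup>2 + gram_form V (AC_comb h (\<Lambda> + d \<cdot>\<^sub>m \<gamma>))"
proof -
  define \<theta> where "\<theta> = d / \<Delta>"
  have \<theta>: "0 \<le> \<theta>" "\<theta> \<le> 1" "\<theta> * \<Delta> = d"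
    using assms(6-8) by (auto simp: \<theta>_def)
  define l where "l = (\<lambda>m. \<Sum>p<dim_vec h + 1. m $ p * inner (V 0) (V (Suc p)))"
  define N where "N = (\<lambda>X. gram_form (V \<circ> Suc) (M_blk h X))"
  have AC: "gram_form V (AC_comb h X) = 2 * l (m_blk h X) + N X" for X
    unfolding AC_comb_blocks l_def N_def
    by (subst gram_form_bordered[OF dim_m_blk M_blk_carrier]) simp
  \<comment> \<open>Setting the first vector to 0 removes the border, so linearity of
    \<open>N\<close> is inherited from that of the full form.\<close>
  have N: "N X = gram_form (V(0 := 0)) (AC_comb h X)" for X
    unfolding AC_comb_blocks N_def
    by (subst gram_form_bordered[OF dim_m_blk M_blk_carrier]) (simp add: comp_def)
  have N_add: "N (\<Lambda> + c \<cdot>\<^sub>m \<gamma>) = N \<Lambda> + c * N \<gamma>" for c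
    unfolding N by (rule gram_form_AC_comb_add_smult[OF car])
  \<comment> \<open>Shrinking the first vector by \<open>d\<close> turns the block \<open>m_blk h \<gamma>\<close> of the certificate into
    that of \<open>d \<cdot>\<^sub>m \<gamma>\<close>.\<close>
  have scaled: "0 \<le> s * d\<^sup>2 * (norm (V 0))\<^sup>2 + 2 * d * l (m_blk h \<gamma>) + N X"
    if "psd (bordered s (m_blk h \<gamma>) (M_blk h X))" for X
  proof -
    have "0 \<le> gram_form (V(0 := d *\<^sub>R V 0)) (bordered s (m_blk h \<gamma>) (M_blk h X))"
      by (rule gram_form_nonneg[OF that])
    also have "\<dots> = s * d\<^sup>2 * (norm (V 0))\<^sup>2 + 2 * d * l (m_blk h \<gamma>) + N X"
      by (subst gram_form_bordered[OF dim_m_blk M_blk_carrier])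
        (simp add: comp_def N_def l_def power_mult_distrib sum_distrib_left mult_ac
          del: sum.lessThan_Suc)
    finally show ?thesis .
  qed
  have "l (m_blk h \<Lambda>) = 0"
    by (simp add: m l_def)
  then have "s * d\<^sup>2 * (norm (V 0))\<^sup>2 + gram_form V (AC_comb h (\<Lambda> + d \<cdot>\<^sub>m \<gamma>))
      = s * d\<^sup>2 * (norm (V 0))\<^sup>2 + 2 * d * l (m_blk h \<gamma>) + N \<Lambda> + d * N \<gamma>"
    by (simp add: gram_form_AC_comb_add_smult[OF car] AC N_add algebra_simps)
  \<comment> \<open>The weights sum to 1, which preserves the common terms, while
    \<open>\<theta> * \<Delta> = d\<close> restores the coefficient of
    \<open>N \<gamma>\<close>.\<close>
  also have "\<dots> = (1 - \<theta>) * (s * d\<^sup>2 * (norm (V 0))\<^sup>2 + 2 * d * l (m_blk h \<gamma>) + N \<Lambda>) +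
      \<theta> * (s * d\<^sup>2 * (norm (V 0))\<^sup>2 + 2 * d * l (m_blk h \<gamma>) + N (\<Lambda> + \<Delta> \<cdot>\<^sub>m \<gamma>))"
    unfolding N_add \<theta>(3)[symmetric] by (simp add: algebra_simps)
  also have "\<dots> \<ge> 0"
    by (intro add_nonneg_nonneg mult_nonneg_nonneg scaled psd1 psd2) (use \<theta> in auto)
  finally show ?thesis .
qed

text \<open>Evaluation at the first unit vector isolates the corner. Stepsizes may be negative, so
  the sign of \<open>s\<close> has to come from semidefiniteness.\<close>

lemma bordered_corner_nonneg:
  assumes "psd (bordered s m M)" and "dim_vec m = n" and "M \<in> carrier_mat n n"
  shows "0 \<le> s"
proof -
  define V where "V = (\<lambda>p::nat. if p = 0 then 1 else 0 :: real)"
  have "gram_form (V \<circ> Suc) M = 0"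
    by (simp add: gram_form_def V_def)
  then show ?thesis
    using gram_form_nonneg[OF assms(1), of V]
    by (simp add: gram_form_bordered[OF assms(2,3)] V_def)
qed

text \<open>Here \<open>\<phi>\<close> and \<open>V\<close> are arbitrary and \<open>interp\<close>
  is the only trace of the function. Its inequalities are summed with the weights
  \<open>\<mu>\<close>: the linear parts collapse by the two equations for \<open>a_comb\<close>,
  and the quadratic part is controlled by \<open>bordered_blocks_nonneg\<close>.\<close>

lemma certificate_bound:
  fixes V :: "nat \<Rightarrow> 'a::euclidean_space" and \<phi> :: "nat \<Rightarrow> real" and h \<epsilon>
  defines "t \<equiv> dim_vec h" and "s \<equiv> (\<Sum>i<dim_vec h. h $ i + \<epsilon>)"
  assumes cert: "(\<Lambda>, \<gamma>) \<in> certificates h \<epsilon> \<Delta>" and \<Delta>: "0 < \<Delta>" and d: "0 \<le> d" "d \<le> \<Delta>"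
    and interp: "\<And>i j. i < t + 2 \<Longrightarrow> j < t + 2 \<Longrightarrow> vec_comb \<phi> (avec t i j) +
      inner (vec_comb V (gvec t j)) (vec_comb V (xvec h i) - vec_comb V (xvec h j)) +
      (norm (vec_comb V (gvec t i) - vec_comb V (gvec t j)))\<^sup>2 / 2 \<le> 0"
  shows "\<phi> t \<le> (1 - 2 * d * (\<Sum>i<t. h $ i)) * \<phi> 0 + s * d\<^sup>2 * (norm (V 0))\<^sup>2"
proof -
  have car: "\<Lambda> \<in> carrier_mat (t + 2) (t + 2)" "\<gamma> \<in> carrier_mat (t + 2) (t + 2)"
    and a: "a_comb t \<Lambda> = avec t 0 (Suc t) - avec t 0 (Suc 0)"
      "a_comb t \<gamma> = (2 * (\<Sum>i<t. h $ i)) \<cdot>\<^sub>v avec t 0 (Suc 0)"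
    and m: "m_blk h \<Lambda> = 0\<^sub>v (t + 1)"
    and nonneg: "nonneg_mat \<Lambda>" "nonneg_mat (\<Lambda> + \<Delta> \<cdot>\<^sub>m \<gamma>)"
    and psd: "psd (bordered s (m_blk h \<gamma>) (M_blk h \<Lambda>))"
      "psd (bordered s (m_blk h \<gamma>) (M_blk h (\<Lambda> + \<Delta> \<cdot>\<^sub>m \<gamma>)))"
    using cert unfolding certificates_def Let_def t_def s_def by auto
  define \<mu> where "\<mu> = \<Lambda> + d \<cdot>\<^sub>m \<gamma>"
  have \<mu>_nonneg: "0 \<le> \<mu> $$ (i, j)" if "i < t + 2" "j < t + 2" for i j
  proof -
    define \<theta> where "\<theta> = d / \<Delta>"
    have \<theta>: "0 \<le> \<theta>" "\<theta> \<le> 1" "\<theta> * \<Delta> = d"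
      using \<Delta> d by (auto simp: \<theta>_def)
    have "0 \<le> \<Lambda> $$ (i, j)" "0 \<le> \<Lambda> $$ (i, j) + \<Delta> * \<gamma> $$ (i, j)"
      using nonneg that car unfolding nonneg_mat_def by auto
    then have "0 \<le> (1 - \<theta>) * \<Lambda> $$ (i, j) + \<theta> * (\<Lambda> $$ (i, j) + \<Delta> * \<gamma> $$ (i, j))"
      using \<theta> by (intro add_nonneg_nonneg[OF mult_nonneg_nonneg mult_nonneg_nonneg]) auto
    also have "\<dots> = \<mu> $$ (i, j)"
      using that car unfolding \<mu>_def \<theta>(3)[symmetric] by (simp add: algebra_simps)
    finally show ?thesis .
  qed
  have a0: "vec_comb \<phi> (avec t 0 (Suc i)) = \<phi> i" if "i \<le> t" for i
    using that by (simp add: vec_comb_avec vec_comb_fvec del: fvec.simps)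
  have "(\<Sum>(i, j)\<in>off_diag t. \<mu> $$ (i, j) * vec_comb \<phi> (avec t i j))
      = vec_comb \<phi> (a_comb t \<Lambda>) + d * vec_comb \<phi> (a_comb t \<gamma>)"
    unfolding vec_comb_a_comb sum_distrib_left sum.distrib[symmetric]
    by (intro sum.cong refl) (use car in \<open>auto simp: \<mu>_def off_diag_def algebra_simps\<close>)
  also have "\<dots> = \<phi> t - \<phi> 0 + d * (2 * (\<Sum>i<t. h $ i) * \<phi> 0)"
    unfolding a by (simp add: vec_comb_smult vec_comb_minus dim_avec a0)
  finally have A: "(\<Sum>(i, j)\<in>off_diag t. \<mu> $$ (i, j) * vec_comb \<phi> (avec t i j))
      = \<phi> t - \<phi> 0 + d * (2 * (\<Sum>i<t. h $ i) * \<phi> 0)" .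
  have "(\<Sum>(i, j)\<in>off_diag t. \<mu> $$ (i, j) * vec_comb \<phi> (avec t i j)) + gram_form V (AC_comb h \<mu>) \<le> 0"
    unfolding gram_form_AC_comb t_def[symmetric] sum.distrib[symmetric]
  proof (rule sum_nonpos, clarsimp simp del: gvec.simps xvec.simps, goal_cases)
    case (1 i j)
    then have "i < t + 2" "j < t + 2" by (auto simp: off_diag_def)
    from mult_nonneg_nonpos[OF \<mu>_nonneg[OF this] interp[OF this]]
    show ?case by (simp add: algebra_simps)
  qed
  moreover have "0 \<le> s * d\<^sup>2 * (norm (V 0))\<^sup>2 + gram_form V (AC_comb h \<mu>)"
    unfolding \<mu>_def
    using bordered_blocks_nonneg[OF car[unfolded t_def] m[unfolded t_def] psd \<Delta> d] .
  ultimately show ?thesis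
    unfolding A by (simp add: algebra_simps)
qed

theorem theorem3p1:
  fixes t :: nat and h :: "real Matrix.vec" and \<epsilon> :: real
  assumes "t \<ge> 1" and "h \<in> carrier_vec t" and "\<epsilon> \<ge> 0"
    and "\<exists>\<Delta>. 0 < \<Delta> \<and> \<Delta> \<le> 1/2 \<and> certificates h \<epsilon> \<Delta> \<noteq> {}"
  shows "straightforward TYPE('n::finite) h \<epsilon>"
proof -
  have t: "dim_vec h = t" using assms(2) by auto
  obtain \<Delta> \<Lambda> \<gamma> where \<Delta>: "0 < \<Delta>" "\<Delta> \<le> 1/2" and cert: "(\<Lambda>, \<gamma>) \<in> certificates h \<epsilon> \<Delta>"
    using assms(4) by auto
  define H where "H = (\<Sum>i<t. h $ i)"
  define s where "s = (\<Sum>i<t. h $ i + \<epsilon>)"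
  \<comment> \<open>The decrease \<open>2 * H\<close> of the linear term minus the cost
    \<open>s\<close> of the quadratic term; the \<open>+ \<epsilon>\<close> inside \<open>s\<close>
    thus becomes \<open>- \<epsilon>\<close> in the rate.\<close>
  have sum_minus: "(\<Sum>i<t. h $ i - \<epsilon>) = 2 * H - s"
    by (simp add: H_def s_def sum.distrib sum_subtractf)
  have "psd (bordered s (m_blk h \<gamma>) (M_blk h \<Lambda>))"
    using cert unfolding certificates_def Let_def s_def t by auto
  then have s: "0 \<le> s"
    by (rule bordered_corner_nonneg[OF _ dim_m_blk M_blk_carrier])
  \<comment> \<open>Keeps the factor of \<open>f (x 0) - f xs\<close> in \<open>certificate_bound\<close> nonnegative.\<close>
  define \<Delta>' where "\<Delta>' = min \<Delta> (1 / (2 * (\<bar>H\<bar> + 1)))"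
  have \<Delta>': "0 < \<Delta>'" "\<Delta>' \<le> \<Delta>" "\<Delta>' * (2 * (\<bar>H\<bar> + 1)) \<le> 1"
  proof -
    show "0 < \<Delta>'" "\<Delta>' \<le> \<Delta>" using \<Delta> by (auto simp: \<Delta>'_def)
    have "\<Delta>' \<le> 1 / (2 * (\<bar>H\<bar> + 1))" by (simp add: \<Delta>'_def)
    then show "\<Delta>' * (2 * (\<bar>H\<bar> + 1)) \<le> 1" by (simp add: pos_le_divide_eq)
  qed
  have bound: "f (x t) - f xs \<le> \<delta> - (\<Sum>i<t. h $ i - \<epsilon>) / (L * D\<^sup>2) * \<delta>\<^sup>2"
    if LD: "L > 0" "D > 0" and \<delta>: "0 \<le> \<delta>" "\<delta> \<le> L * D\<^sup>2 * \<Delta>'"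
      and f: "convex_on UNIV f" "\<And>y. GDERIV f y :> g y" "L-lipschitz_on UNIV g"
      and g0: "g xs = 0" and x0: "norm (x 0 - xs) \<le> D" and f0: "f (x 0) - f xs \<le> \<delta>"
      and step: "\<And>k. k < t \<Longrightarrow> x (Suc k) = x k - (h $ k / L) *\<^sub>R g (x k)"
    for L D \<delta> and f :: "real ^ 'n \<Rightarrow> real" and g x xs
  proof -
    define d where "d = \<delta> / (L * D\<^sup>2)"
    \<comment> \<open>Dividing gradients and function values by \<open>L\<close> normalizes the
      smoothness constant to 1, so the stepsizes become the plain \<open>h $ k\<close>. Index 0 of
      \<open>V\<close> is the initial displacement, whereas index 0 of \<open>y\<close> is the
      minimizer.\<close>
    define V where "V = (\<lambda>p. case p of 0 \<Rightarrow> x 0 - xs | Suc i \<Rightarrow> (1 / L) *\<^sub>R g (x i))"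
    define \<phi> where "\<phi> = (\<lambda>i. (f (x i) - f xs) / L)"
    define y where "y = (\<lambda>i. case i of 0 \<Rightarrow> xs | Suc k \<Rightarrow> x k)"
    have d: "0 \<le> d" "d \<le> \<Delta>'"
      using LD \<delta> by (auto simp: d_def field_simps)
    have x_sum: "x i = x 0 - (\<Sum>j<i. h $ j *\<^sub>R V (Suc j))" if "i \<le> t" for i
      using that
    proof (induction i)
      case (Suc i)
      then show ?case using step[of i] by (simp add: V_def)
    qed simp
    have Vg: "vec_comb V (gvec t i) = (1 / L) *\<^sub>R g (y i)" if "i < t + 2" for i
      using that g0 by (cases i) (auto simp: y_def V_def vec_comb_gvec simp del: gvec.simps)
    \<comment> \<open>The symbolic points are centered at the minimizer; the shift by
      \<open>xs\<close> cancels in the differences that enter \<open>interp\<close>.\<close>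
    have Vx: "vec_comb V (xvec h i) = y i - xs" if "i < t + 2" for i
    proof (cases i)
      case 0
      then show ?thesis by (simp add: vec_comb_xvec y_def del: xvec.simps)
    next
      case (Suc k)
      then have "k \<le> t" using that by simp
      then show ?thesis
        using vec_comb_xvec(2)[of k h V] x_sum[of k] by (simp add: Suc t y_def V_def)
    qed
    have Vf: "vec_comb \<phi> (fvec t i) = (f (y i) - f xs) / L" if "i < t + 2" for i
      using that by (cases i) (auto simp: y_def \<phi>_def vec_comb_fvec simp del: fvec.simps)
    have "\<phi> t \<le> (1 - 2 * d * H) * \<phi> 0 + s * d\<^sup>2 * (norm (V 0))\<^sup>2"
      unfolding H_def s_def t[symmetric]
    proof (rule certificate_bound[OF cert \<Delta>(1)], unfold t)
      show "0 \<le> d" "d \<le> \<Delta>" using d \<Delta>' by auto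
      fix i j assume ij: "i < t + 2" "j < t + 2"
      have "f (y i) \<ge> f (y j) + inner (g (y j)) (y i - y j) + (norm (g (y i) - g (y j)))\<^sup>2 / (2 * L)"
        by (rule smooth_convex_interpolation[OF LD(1) f])
      then have "(f (y j) + inner (g (y j)) (y i - y j) + (norm (g (y i) - g (y j)))\<^sup>2 / (2 * L)
          - f (y i)) / L \<le> 0"
        using LD(1) by (simp add: divide_le_0_iff)
      moreover have "(norm ((1 / L) *\<^sub>R g (y i) - (1 / L) *\<^sub>R g (y j)))\<^sup>2
          = (norm (g (y i) - g (y j)))\<^sup>2 / L\<^sup>2"
        unfolding scaleR_right_diff_distrib[symmetric] by (simp add: power_divide)
      ultimately show "vec_comb \<phi> (avec t i j) +
          inner (vec_comb V (gvec t j)) (vec_comb V (xvec h i) - vec_comb V (xvec h j)) +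
          (norm (vec_comb V (gvec t i) - vec_comb V (gvec t j)))\<^sup>2 / 2 \<le> 0"
        unfolding vec_comb_avec Vf[OF ij(1)] Vf[OF ij(2)] Vg[OF ij(1)] Vg[OF ij(2)]
          Vx[OF ij(1)] Vx[OF ij(2)]
        by (simp add: add_divide_distrib diff_divide_distrib power2_eq_square)
    qed
    \<comment> \<open>The bounds on the initial gap and on the initial distance may be inserted
      because both coefficients are nonnegative.\<close>
    also have "\<dots> \<le> (1 - 2 * d * H) * (\<delta> / L) + s * d\<^sup>2 * D\<^sup>2"
    proof (intro add_mono mult_left_mono)
      show "\<phi> 0 \<le> \<delta> / L" using f0 LD by (simp add: \<phi>_def divide_right_mono)
      have "2 * d * H \<le> d * (2 * (\<bar>H\<bar> + 1))"
        using mult_left_mono[OF _ d(1), of "2 * H" "2 * (\<bar>H\<bar> + 1)"] by (simp add: mult_ac)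
      also have "\<dots> \<le> \<Delta>' * (2 * (\<bar>H\<bar> + 1))"
        using d(2) by (intro mult_right_mono) auto
      also have "\<dots> \<le> 1" by (rule \<Delta>'(3))
      finally show "0 \<le> 1 - 2 * d * H" by simp
      show "(norm (V 0))\<^sup>2 \<le> D\<^sup>2"
        using x0 by (simp add: V_def power_mono)
    qed (use s in simp)
    finally have "L * \<phi> t \<le> L * ((1 - 2 * d * H) * (\<delta> / L) + s * d\<^sup>2 * D\<^sup>2)"
      using LD by simp
    \<comment> \<open>With \<open>d = \<delta> / (L * D\<^sup>2)\<close>, both
      \<open>2 * d * H * \<delta>\<close> and \<open>L * s * d\<^sup>2 * D\<^sup>2\<close> are
      multiples of \<open>\<delta>\<^sup>2 / (L * D\<^sup>2)\<close>, with factors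
      \<open>2 * H\<close> and \<open>s\<close>.\<close>
    also have "\<dots> = \<delta> - (\<Sum>i<t. h $ i - \<epsilon>) / (L * D\<^sup>2) * \<delta>\<^sup>2"
      unfolding sum_minus d_def using LD by (simp add: field_simps power2_eq_square)
    finally show ?thesis
      using LD by (simp add: \<phi>_def)
  qed
  show ?thesis
    unfolding straightforward_def worst_case_def t
  proof (intro exI[of _ \<Delta>'] conjI allI impI ballI Sup_least)
    show "0 < \<Delta>'" "\<Delta>' \<le> 1 / 2" using \<Delta> \<Delta>' by auto
  next
    fix L D \<delta> :: real and z
    assume LD: "0 < L" "0 < D" and \<delta>_in: "\<delta> \<in> {0..L * D\<^sup>2 * \<Delta>'}"
      and z_in: "z \<in> {ereal (f (x t) - f xs) | (f :: real ^ 'n \<Rightarrow> real) g x xs.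
            convex_on UNIV f \<and> (\<forall>y. GDERIV f y :> g y) \<and> L-lipschitz_on UNIV g \<and>
            g xs = 0 \<and> norm (x 0 - xs) \<le> D \<and> f (x 0) - f xs \<le> \<delta> \<and>
            (\<forall>k<t. x (Suc k) = x k - (h $ k / L) *\<^sub>R g (x k))}"
    have \<delta>: "0 \<le> \<delta>" "\<delta> \<le> L * D\<^sup>2 * \<Delta>'" using \<delta>_in by simp_all
    from z_in obtain f :: "real ^ 'n \<Rightarrow> real" and g x xs where z: "z = ereal (f (x t) - f xs)"
      and f: "convex_on UNIV f" "\<forall>y. GDERIV f y :> g y" "L-lipschitz_on UNIV g"
      and x: "g xs = 0" "norm (x 0 - xs) \<le> D" "f (x 0) - f xs \<le> \<delta>"
        "\<forall>k<t. x (Suc k) = x k - (h $ k / L) *\<^sub>R g (x k)"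
      unfolding mem_Collect_eq by (elim exE conjE)
    have "f (x t) - f xs \<le> \<delta> - (\<Sum>i<t. h $ i - \<epsilon>) / (L * D\<^sup>2) * \<delta>\<^sup>2"
      by (rule bound[of L D \<delta> f g xs x, OF LD \<delta> f(1) f(2)[rule_format] f(3) x(1-3) x(4)[rule_format]])
    then show "z \<le> ereal (\<delta> - (\<Sum>i<t. h $ i - \<epsilon>) / (L * D\<^sup>2) * \<delta>\<^sup>2)"
      by (simp only: z ereal_less_eq)
  qed
qed

end
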